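(* Let $k,\ell$ be integers with $1 < k < \ell - 2$. Then for all sufficiently large $n$ with $k \mid n$ and $\ell \mid n$, every planar graph that contains each of $C_{n,1}$, $C_{n,k}$ and $C_{n,\ell}$ as a subgraph has at least \[ \left(\frac{3}{2} - \frac{1}{k} - \frac{k}{\ell}\right) n - (k-1)(\ell-k) - \frac{\ell}{2} \] vertices.
   Context: A caterpillar is a tree in which the subgraph induced by the vertices of degree at least two is a path, called the spine. For positive integers $n,m$ with $m \mid n$, the $m$-caterpillar on $n$ vertices $C_{n,m}$ is the caterpillar whose spine is a path on $m$ vertices and in which every spine vertex is adjacent to exactly $\frac{n}{m}-1$ leaves; thus $C_{n,m}$ has $n$ vertices, and $C_{n,1}$ is the star $K_{1,n-1}$. Contained as a subgraph means there is an injective map of vertices sending edges to edges. *)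

theory Defs
  imports "HOL-Analysis.Analysis" "Graph_Theory.Pair_Digraph"
begin

text \<open>
  A finite simple undirected graph is a \<^const>\<open>pair_graph\<close>: a finite, loop-free, symmetric
  relation \<^const>\<open>parcs\<close> on \<^const>\<open>pverts\<close>, in which an edge \<open>uv\<close> appears as both \<open>(u, v)\<close>
  and \<open>(v, u)\<close>.
\<close>

definition contained_in :: "'a pair_pre_digraph \<Rightarrow> 'b pair_pre_digraph \<Rightarrow> bool" where
  "contained_in H G \<longleftrightarrow>
     (\<exists>f. inj_on f (pverts H) \<and> f ` pverts H \<subseteq> pverts G \<and>
          (\<forall>(u, v) \<in> parcs H. (f u, f v) \<in> parcs G))"

text \<open>
  The point \<open>p u\<close> represents the vertex \<open>u\<close>, and the image of \<open>\<gamma> u v\<close> represents the edge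
  \<open>uv\<close>. The condition on \<open>\<gamma> v u\<close> makes the two orientations of an edge the same curve.
\<close>

definition plane_drawing ::
    "'a pair_pre_digraph \<Rightarrow> ('a \<Rightarrow> complex) \<Rightarrow> ('a \<Rightarrow> 'a \<Rightarrow> real \<Rightarrow> complex) \<Rightarrow> bool" where
  "plane_drawing G p \<gamma> \<longleftrightarrow>
     inj_on p (pverts G) \<and>
     (\<forall>(u, v) \<in> parcs G.
        arc (\<gamma> u v) \<and> pathstart (\<gamma> u v) = p u \<and> pathfinish (\<gamma> u v) = p v \<and>
        path_image (\<gamma> v u) = path_image (\<gamma> u v)) \<and>
     (\<forall>(u, v) \<in> parcs G. \<forall>w \<in> pverts G. p w \<in> path_image (\<gamma> u v) \<longrightarrow> w \<in> {u, v}) \<and>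
     (\<forall>(u, v) \<in> parcs G. \<forall>(x, y) \<in> parcs G. {u, v} \<noteq> {x, y} \<longrightarrow>
        path_image (\<gamma> u v) \<inter> path_image (\<gamma> x y) \<subseteq> p ` ({u, v} \<inter> {x, y}))"

definition planar :: "'a pair_pre_digraph \<Rightarrow> bool" where
  "planar G \<longleftrightarrow> (\<exists>p \<gamma>. plane_drawing G p \<gamma>)"

text \<open>
  The vertices \<open>(i, 0)\<close> with \<open>i < m\<close> form the spine, in this order, and the vertices \<open>(i, a)\<close>
  with \<open>0 < a < n div m\<close> are the leaves at \<open>(i, 0)\<close>. The definition is meant for \<open>0 < m\<close> and
  \<open>m dvd n\<close>.
\<close>

definition caterpillar :: "nat \<Rightarrow> nat \<Rightarrow> (nat \<times> nat) pair_pre_digraph" where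
  "caterpillar n m =
     (let V = {..<m} \<times> {..<n div m} in
      \<lparr> pverts = V,
        parcs = {((i, a), (j, b)). (i, a) \<in> V \<and> (j, b) \<in> V \<and>
                   (a = 0 \<and> b = 0 \<and> (j = Suc i \<or> i = Suc j) \<or>
                    i = j \<and> (a = 0 \<longleftrightarrow> b \<noteq> 0))} \<rparr>)"

lemma pair_graph_caterpillar: "pair_graph (caterpillar n m)"
proof -
  have "finite (parcs (caterpillar n m))"
    by (rule finite_subset[of _ "({..<m} \<times> {..<n div m}) \<times> ({..<m} \<times> {..<n div m})"])
      (auto simp: caterpillar_def Let_def)
  moreover have "sym (parcs (caterpillar n m))"
    by (auto simp: sym_def caterpillar_def Let_def)
  ultimately show ?thesis
    by unfold_locales (auto simp: caterpillar_def Let_def symmetric_def)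
qed

lemma card_caterpillar: "m dvd n \<Longrightarrow> card (pverts (caterpillar n m)) = n"
  by (simp add: caterpillar_def Let_def card_cartesian_product)

lemma card_caterpillar_leaves:
  assumes "i < m"
  shows "card {b. b \<noteq> 0 \<and> ((i, 0), (i, b)) \<in> parcs (caterpillar n m)} = n div m - 1"
proof -
  have "{b. b \<noteq> 0 \<and> ((i, 0), (i, b)) \<in> parcs (caterpillar n m)} = {1..<n div m}"
    using assms by (auto simp: caterpillar_def Let_def)
  then show ?thesis by simp
qed

lemma caterpillar_leaf_neighbours:
  assumes "i < m" "0 < a" "a < n div m"
  shows "{v. ((i, a), v) \<in> parcs (caterpillar n m)} = {(i, 0)}"
  using assms by (auto simp: caterpillar_def Let_def)

end

theory Submission
  imports Defs "HOL-Complex_Analysis.Winding_Numbers"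
begin

text \<open>
  A planar graph contains no \<open>K\<^sub>3\<^sub>,\<^sub>3\<close>, so three distinct vertices have at most two
  common neighbours. Let \<open>s\<close> be the centre of the star, choose \<open>k - 1\<close> spine vertices \<open>u \<noteq> s\<close> of
  \<open>C\<^sub>n\<^sub>,\<^sub>k\<close>, and then \<open>l - k\<close> spine vertices \<open>w\<close> of \<open>C\<^sub>n\<^sub>,\<^sub>l\<close> that differ from \<open>s\<close>
  and from the chosen \<open>u\<close>. Let \<open>A\<close> and \<open>B\<close> be the sets of leaves at the chosen \<open>u\<close> and \<open>w\<close>, and
  \<open>T\<close> the vertex set of the star. Apart from \<open>s\<close>, every vertex of \<open>A \<inter> B \<inter> T\<close> is a common
  neighbour of some \<open>s, u, w\<close>, so \<open>|A \<inter> B \<inter> T| \<le> 1 + 2 (k - 1) (l - k)\<close>, and the bound follows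
  from \<open>|A| + |B| + |T| \<le> 2 |V| + |A \<inter> B \<inter> T|\<close>.
\<close>

section \<open>Three common neighbours are impossible in the plane\<close>

text \<open>A connected set that misses \<open>S\<close> lies in one component of the complement of
  \<open>S\<close>, so it is either wholly inside or wholly free of the inside. This moves points
  along edges below.\<close>

lemma connected_in_inside:
  assumes "connected E" "E \<inter> S = {}" "x \<in> E" "y \<in> E" "x \<in> inside S"
  shows "y \<in> inside S"
proof -
  have "connected_component (- S) x y"
    unfolding connected_component_def using assms by blast
  then show ?thesis
    using assms(5) inside_same_component by blast
qed

text \<open>Since \<open>c3\<close> enters the loop \<open>c1 c2\<close>, it cuts the inside of that
  loop into the insides of \<open>c1 c3\<close> and \<open>c2 c3\<close>. The set \<open>E3\<close>
  pulls \<open>z\<close> into the big inside, hence into one of the two pieces. From the piece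
  bounded by \<open>c1\<close> and \<open>c3\<close>, \<open>E2\<close> would carry
  \<open>x2\<close> strictly inside the loop \<open>c1 c2\<close>, although \<open>x2\<close> lies
  on \<open>c2\<close>; the other piece fails in the same way with \<open>E1\<close> and
  \<open>x1\<close>.\<close>

lemma theta_no_common_access_inside:
  fixes c1 c2 c3 :: "real \<Rightarrow> complex"
  assumes c1: "arc c1" "pathstart c1 = a" "pathfinish c1 = b"
    and c2: "arc c2" "pathstart c2 = a" "pathfinish c2 = b"
    and c3: "arc c3" "pathstart c3 = a" "pathfinish c3 = b"
    and c12: "path_image c1 \<inter> path_image c2 = {a, b}"
    and c13: "path_image c1 \<inter> path_image c3 = {a, b}"
    and c23: "path_image c2 \<inter> path_image c3 = {a, b}"
    and x1: "x1 \<in> path_image c1"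
    and x2: "x2 \<in> path_image c2"
    and x3: "x3 \<in> path_image c3" "x3 \<notin> {a, b}"
    and E1: "connected E1" "z \<in> E1" "x1 \<in> E1" "E1 \<inter> (path_image c2 \<union> path_image c3) = {}"
    and E2: "connected E2" "z \<in> E2" "x2 \<in> E2" "E2 \<inter> (path_image c1 \<union> path_image c3) = {}"
    and E3: "connected E3" "z \<in> E3" "x3 \<in> E3" "E3 \<inter> (path_image c1 \<union> path_image c2) = {}"
    and meets: "path_image c3 \<inter> inside (path_image c1 \<union> path_image c2) \<noteq> {}"
  shows False
proof -
  have "a \<noteq> b"
    using c1 arc_distinct_ends by blast
  then have split: "inside (path_image c1 \<union> path_image c3) \<union> inside (path_image c2 \<union> path_image c3) \<union>
           (path_image c3 - {a, b}) = inside (path_image c1 \<union> path_image c2)"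
    using split_inside_simple_closed_curve[of c1 a b c2 c3] assms arc_imp_simple_path by metis
  have in12: "x3 \<in> inside (path_image c1 \<union> path_image c2)"
    using split x3 by blast
  have "z \<in> inside (path_image c1 \<union> path_image c2)"
    using connected_in_inside[OF E3(1,4,3,2) in12] .
  moreover have "z \<notin> path_image c3"
    using E1 by blast
  ultimately consider "z \<in> inside (path_image c1 \<union> path_image c3)"
    | "z \<in> inside (path_image c2 \<union> path_image c3)"
    using split by blast
  then show False
  proof cases
    case 1
    then have "x2 \<in> inside (path_image c1 \<union> path_image c2)"
      using connected_in_inside[OF E2(1,4,2,3)] split by blast
    then show False
      using inside_no_overlap x2 by blast
  next
    case 2
    then have "x1 \<in> inside (path_image c1 \<union> path_image c2)"
      using connected_in_inside[OF E1(1,4,2,3)] split by blast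
    then show False
      using inside_no_overlap x1 by blast
  qed
qed

text \<open>The Jordan curve theorem for the loop \<open>c +++ reversepath d\<close>, phrased
  through the union of the two images so that it does not depend on a parametrisation. The closure
  claim holds because the loop is the frontier of its inside.\<close>

lemma inside_two_arcs:
  fixes c d :: "real \<Rightarrow> complex"
  assumes "arc c" "pathstart c = a" "pathfinish c = b"
    and "arc d" "pathstart d = a" "pathfinish d = b"
    and "path_image c \<inter> path_image d = {a, b}"
  shows "simple_path (c +++ reversepath d)"
    and "inside (path_image c \<union> path_image d) \<noteq> {}"
    and "connected (inside (path_image c \<union> path_image d))"
    and "open (outside (path_image c \<union> path_image d))"
    and "path_image c \<union> path_image d \<subseteq> closure (inside (path_image c \<union> path_image d))"
proof -
  show sp: "simple_path (c +++ reversepath d)"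
    using assms by (auto simp: simple_path_join_loop_eq arc_reversepath)
  have pi: "path_image (c +++ reversepath d) = path_image c \<union> path_image d"
    using assms by (simp add: path_image_join)
  note J = Jordan_inside_outside[OF sp, unfolded pi]
  have "pathfinish (c +++ reversepath d) = pathstart (c +++ reversepath d)"
    using assms by simp
  note J = J[OF this]
  show "inside (path_image c \<union> path_image d) \<noteq> {}"
    and "connected (inside (path_image c \<union> path_image d))"
    and "open (outside (path_image c \<union> path_image d))"
    using J by auto
  have "frontier (inside (path_image c \<union> path_image d)) = path_image c \<union> path_image d"
    using J by auto
  then show "path_image c \<union> path_image d \<subseteq> closure (inside (path_image c \<union> path_image d))"
    by (auto simp: frontier_def)
qed

text \<open>
  If no arc of a theta curve entered the loop formed by the other two, a point inside the loop
  \<open>c1 c2\<close> would be outside the other two loops. This is impossible because the winding numbers of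
  the three loops are the pairwise differences of those of the arcs.
\<close>

lemma theta_some_arc_meets_inside:
  fixes c1 c2 c3 :: "real \<Rightarrow> complex"
  assumes c1: "arc c1" "pathstart c1 = a" "pathfinish c1 = b"
    and c2: "arc c2" "pathstart c2 = a" "pathfinish c2 = b"
    and c3: "arc c3" "pathstart c3 = a" "pathfinish c3 = b"
    and c12: "path_image c1 \<inter> path_image c2 = {a, b}"
    and c13: "path_image c1 \<inter> path_image c3 = {a, b}"
    and c23: "path_image c2 \<inter> path_image c3 = {a, b}"
    and x1: "x1 \<in> path_image c1" "x1 \<notin> {a, b}"
    and x2: "x2 \<in> path_image c2" "x2 \<notin> {a, b}"
  shows "path_image c3 \<inter> inside (path_image c1 \<union> path_image c2) \<noteq> {} \<or>
         path_image c2 \<inter> inside (path_image c1 \<union> path_image c3) \<noteq> {} \<or>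
         path_image c1 \<inter> inside (path_image c2 \<union> path_image c3) \<noteq> {}"
proof (rule ccontr)
  assume "\<not> ?thesis"
  then have n3: "path_image c3 \<inter> inside (path_image c1 \<union> path_image c2) = {}"
    and n2: "path_image c2 \<inter> inside (path_image c1 \<union> path_image c3) = {}"
    and n1: "path_image c1 \<inter> inside (path_image c2 \<union> path_image c3) = {}"
    by auto
  note J12 = inside_two_arcs[OF c1 c2 c12]
  note J13 = inside_two_arcs[OF c1 c3 c13]
  note J23 = inside_two_arcs[OF c2 c3 c23]
  obtain y where y: "y \<in> inside (path_image c1 \<union> path_image c2)"
    using J12(2) by blast
  have y_notin: "y \<notin> path_image c1" "y \<notin> path_image c2" "y \<notin> path_image c3"
    using y n3 inside_no_overlap[of "path_image c1 \<union> path_image c2"] by blast+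
  \<comment> \<open>Here \<open>d\<close> is \<open>c1\<close> or \<open>c2\<close>, and
    \<open>x\<close> lies on the other of the two. The inside of \<open>c1 c2\<close> is connected
    and misses \<open>d\<close> and \<open>c3\<close>, so it would share the side of
    \<open>y\<close>. But \<open>x\<close> is a limit of its points and lies in the open outside of
    \<open>d c3\<close>, which puts some \<open>w\<close> of it on the wrong side.\<close>
  have outside_other: "y \<in> outside (path_image d \<union> path_image c3)"
    if d: "path_image d \<subseteq> path_image c1 \<union> path_image c2"
      and op: "open (outside (path_image d \<union> path_image c3))"
      and x: "x \<in> path_image c1 \<union> path_image c2" "x \<notin> path_image d \<union> path_image c3"
        "x \<notin> inside (path_image d \<union> path_image c3)"
    for d :: "real \<Rightarrow> complex" and x
  proof (rule ccontr)
    assume "y \<notin> outside (path_image d \<union> path_image c3)"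
    then have yin: "y \<in> inside (path_image d \<union> path_image c3)"
      using y_notin d inside_Un_outside[of "path_image d \<union> path_image c3"] by blast
    have disj: "inside (path_image c1 \<union> path_image c2) \<inter> (path_image d \<union> path_image c3) = {}"
      using d n3 inside_no_overlap[of "path_image c1 \<union> path_image c2"] by blast
    have "x \<in> outside (path_image d \<union> path_image c3)"
      using x inside_Un_outside[of "path_image d \<union> path_image c3"] by blast
    moreover have "x \<in> closure (inside (path_image c1 \<union> path_image c2))"
      using J12(5) x by blast
    ultimately obtain w where w: "w \<in> inside (path_image c1 \<union> path_image c2)"
        "w \<in> outside (path_image d \<union> path_image c3)"
      using op open_Int_closure_eq_empty[of "outside (path_image d \<union> path_image c3)"
          "inside (path_image c1 \<union> path_image c2)"] by blast
    have "w \<in> inside (path_image d \<union> path_image c3)"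
      using connected_in_inside[OF J12(3) disj y w(1) yin] .
    then show False
      using w(2) inside_Int_outside by blast
  qed
  have y13: "y \<in> outside (path_image c1 \<union> path_image c3)"
    using outside_other[of c1 x2] J13(4) x2 n2 c12 c23 by blast
  have y23: "y \<in> outside (path_image c2 \<union> path_image c3)"
    using outside_other[of c2 x1] J23(4) x1 n1 c12 c13 by blast
  have wn: "winding_number (c +++ reversepath d) y = winding_number c y - winding_number d y"
    if "arc c" "pathfinish c = b" "arc d" "pathfinish d = b"
      "y \<notin> path_image c" "y \<notin> path_image d" for c d
    using that by (simp add: winding_number_join winding_number_reversepath arc_imp_path)
  have "winding_number (c1 +++ reversepath c3) y = 0"
    by (rule winding_number_zero_in_outside)
      (use c1 c3 y13 J13(1) in \<open>auto simp: path_image_join simple_path_imp_path\<close>)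
  moreover have "winding_number (c2 +++ reversepath c3) y = 0"
    by (rule winding_number_zero_in_outside)
      (use c2 c3 y23 J23(1) in \<open>auto simp: path_image_join simple_path_imp_path\<close>)
  \<comment> \<open>\<open>c1\<close> and \<open>c2\<close> both have the winding number of
    \<open>c3\<close> about \<open>y\<close>, so their difference vanishes; inside a simple loop it
    must have norm 1.\<close>
  ultimately have "winding_number (c1 +++ reversepath c2) y = 0"
    using wn c1 c2 c3 y_notin by simp
  moreover have "norm (winding_number (c1 +++ reversepath c2) y) = 1"
    by (rule simple_closed_path_norm_winding_number_inside)
      (use c1 c2 y J12(1) in \<open>auto simp: path_image_join\<close>)
  ultimately show False by simp
qed

text \<open>Topologically this is the nonplanarity of \<open>K_{3,3}\<close> with sides
  \<open>a, b, z\<close> and \<open>x1, x2, x3\<close>. Some arc enters the loop of the other two,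
  and after relabelling the arcs it takes the role of \<open>c3\<close> in the one-sided
  version.\<close>

lemma theta_no_common_access:
  fixes c1 c2 c3 :: "real \<Rightarrow> complex"
  assumes c1: "arc c1" "pathstart c1 = a" "pathfinish c1 = b"
    and c2: "arc c2" "pathstart c2 = a" "pathfinish c2 = b"
    and c3: "arc c3" "pathstart c3 = a" "pathfinish c3 = b"
    and c12: "path_image c1 \<inter> path_image c2 = {a, b}"
    and c13: "path_image c1 \<inter> path_image c3 = {a, b}"
    and c23: "path_image c2 \<inter> path_image c3 = {a, b}"
    and x1: "x1 \<in> path_image c1" "x1 \<notin> {a, b}"
    and x2: "x2 \<in> path_image c2" "x2 \<notin> {a, b}"
    and x3: "x3 \<in> path_image c3" "x3 \<notin> {a, b}"
    and E1: "connected E1" "z \<in> E1" "x1 \<in> E1" "E1 \<inter> (path_image c2 \<union> path_image c3) = {}"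
    and E2: "connected E2" "z \<in> E2" "x2 \<in> E2" "E2 \<inter> (path_image c1 \<union> path_image c3) = {}"
    and E3: "connected E3" "z \<in> E3" "x3 \<in> E3" "E3 \<inter> (path_image c1 \<union> path_image c2) = {}"
  shows False
proof -
  consider "path_image c3 \<inter> inside (path_image c1 \<union> path_image c2) \<noteq> {}"
    | "path_image c2 \<inter> inside (path_image c1 \<union> path_image c3) \<noteq> {}"
    | "path_image c1 \<inter> inside (path_image c2 \<union> path_image c3) \<noteq> {}"
    using theta_some_arc_meets_inside[OF c1 c2 c3 c12 c13 c23 x1 x2] by blast
  then show False
  proof cases
    case 1
    show False
      by (rule theta_no_common_access_inside[OF c1 c2 c3 c12 c13 c23 x1(1) x2(1) x3 E1 E2 E3 1])
  next
    case 2
    have "path_image c3 \<inter> path_image c2 = {a, b}"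
      and "E1 \<inter> (path_image c3 \<union> path_image c2) = {}"
      using c23 E1(4) by blast+
    then show False
      using theta_no_common_access_inside[OF c1 c3 c2 c13 c12 _ x1(1) x3(1) x2 E1(1-3) _ E3 E2 2]
      by blast
  next
    case 3
    have "path_image c2 \<inter> path_image c1 = {a, b}" "path_image c3 \<inter> path_image c1 = {a, b}"
      and "E2 \<inter> (path_image c3 \<union> path_image c1) = {}" "E3 \<inter> (path_image c2 \<union> path_image c1) = {}"
      using c12 c13 E2(4) E3(4) by blast+
    then show False
      using theta_no_common_access_inside[OF c2 c3 c1 c23 _ _ x2(1) x3(1) x1 E2(1-3) _ E3(1-3) _ E1 3]
      by blast
  qed
qed

text \<open>Three common neighbours would complete a \<open>K_{3,3}\<close>: the paths from
  \<open>x\<close> to \<open>y\<close> through them form a theta curve, and the edges from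
  \<open>z\<close> give the three connected sets that reach its arcs.\<close>

lemma planar_common_neighbours:
  assumes G: "pair_graph G" and "planar G"
    and distinct: "x \<noteq> y" "x \<noteq> z" "y \<noteq> z"
  shows "card {v. (x, v) \<in> parcs G \<and> (y, v) \<in> parcs G \<and> (z, v) \<in> parcs G} \<le> 2"
    (is "card ?C \<le> 2")
proof (rule ccontr)
  assume "\<not> card ?C \<le> 2"
  then obtain D where "D \<subseteq> ?C" "card D = 3"
    using obtain_subset_with_card_n[of 3 ?C] by auto
  then obtain b1 b2 b3 where b: "{b1, b2, b3} \<subseteq> ?C" "b1 \<noteq> b2" "b1 \<noteq> b3" "b2 \<noteq> b3"
    by (auto simp: card_3_iff)
  interpret pair_graph G by fact
  obtain p \<gamma> where drawing: "plane_drawing G p \<gamma>"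
    using \<open>planar G\<close> planar_def by blast
  have sym: "(v, u) \<in> parcs G" if "(u, v) \<in> parcs G" for u v
    using that arcs_symmetric by simp
  have inj: "p u = p v \<longleftrightarrow> u = v" if "u \<in> pverts G" "v \<in> pverts G" for u v
    using drawing that by (auto simp: plane_drawing_def inj_on_def)
  have arc: "Path_Connected.arc (\<gamma> u v)" "pathstart (\<gamma> u v) = p u" "pathfinish (\<gamma> u v) = p v"
    if "(u, v) \<in> parcs G" for u v
    using drawing that by (auto simp: plane_drawing_def)
  have cross: "path_image (\<gamma> u v) \<inter> path_image (\<gamma> u' v') \<subseteq> p ` ({u, v} \<inter> {u', v'})"
    if "(u, v) \<in> parcs G" "(u', v') \<in> parcs G" "{u, v} \<noteq> {u', v'}" for u v u' v'
    using drawing that unfolding plane_drawing_def by blast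
  have ends: "p u \<in> path_image (\<gamma> u v)" "p v \<in> path_image (\<gamma> u v)" if "(u, v) \<in> parcs G" for u v
    using arc[OF that] pathstart_in_path_image[of "\<gamma> u v"] pathfinish_in_path_image[of "\<gamma> u v"]
    by auto
  \<comment> \<open>The arc of the theta curve through \<open>v\<close>; \<open>p v\<close> is its
    marked interior point.\<close>
  define c where "c v = \<gamma> x v +++ \<gamma> v y" for v
  have common: "(x, v) \<in> parcs G" "(y, v) \<in> parcs G" "(z, v) \<in> parcs G"
    "(v, x) \<in> parcs G" "(v, y) \<in> parcs G" "(v, z) \<in> parcs G"
    "x \<noteq> v" "y \<noteq> v" "z \<noteq> v"
    if "v \<in> {b1, b2, b3}" for v
    using b that sym no_loops by fastforce+
  have vertex: "x \<in> pverts G" "y \<in> pverts G" "z \<in> pverts G" "v \<in> pverts G"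
    if "v \<in> {b1, b2, b3}" for v
    using common[OF that] in_arcsD1 in_arcsD2 by blast+
  have c_image: "path_image (c v) = path_image (\<gamma> x v) \<union> path_image (\<gamma> v y)"
    if "v \<in> {b1, b2, b3}" for v
    using arc common[OF that] by (simp add: c_def path_image_join)
  have c_arc: "Path_Connected.arc (c v)" "pathstart (c v) = p x" "pathfinish (c v) = p y" "p v \<in> path_image (c v)"
    if v: "v \<in> {b1, b2, b3}" for v
  proof -
    have "path_image (\<gamma> x v) \<inter> path_image (\<gamma> v y) \<subseteq> {p v}"
      using cross[of x v v y] common[OF v] distinct by (auto simp: doubleton_eq_iff)
    then show "Path_Connected.arc (c v)"
      using arc common[OF v] by (simp add: c_def arc_join)
    show "pathstart (c v) = p x" "pathfinish (c v) = p y"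
      using arc common[OF v] by (simp_all add: c_def)
    show "p v \<in> path_image (c v)"
      using c_image[OF v] ends common[OF v] by blast
  qed
  have c_Int: "path_image (c v) \<inter> path_image (c w) = {p x, p y}"
    if v: "v \<in> {b1, b2, b3}" and w: "w \<in> {b1, b2, b3}" and "v \<noteq> w" for v w
  proof
    note edges = common[OF v] common[OF w]
    have "path_image (\<gamma> x v) \<inter> path_image (\<gamma> x w) \<subseteq> {p x}"
      using cross[of x v x w] edges \<open>v \<noteq> w\<close> by (auto simp: doubleton_eq_iff)
    moreover have "path_image (\<gamma> x v) \<inter> path_image (\<gamma> w y) \<subseteq> {}"
      using cross[of x v w y] edges \<open>v \<noteq> w\<close> distinct by (auto simp: doubleton_eq_iff)
    moreover have "path_image (\<gamma> v y) \<inter> path_image (\<gamma> x w) \<subseteq> {}"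
      using cross[of v y x w] edges \<open>v \<noteq> w\<close> distinct by (auto simp: doubleton_eq_iff)
    moreover have "path_image (\<gamma> v y) \<inter> path_image (\<gamma> w y) \<subseteq> {p y}"
      using cross[of v y w y] edges \<open>v \<noteq> w\<close> by (auto simp: doubleton_eq_iff)
    ultimately show "path_image (c v) \<inter> path_image (c w) \<subseteq> {p x, p y}"
      unfolding c_image[OF v] c_image[OF w] by blast
    show "{p x, p y} \<subseteq> path_image (c v) \<inter> path_image (c w)"
      unfolding c_image[OF v] c_image[OF w] using ends edges by blast
  qed
  \<comment> \<open>The edge \<open>zv\<close> shares no end with the edges \<open>xw\<close> and
    \<open>wy\<close>, so the drawing keeps their curves disjoint.\<close>
  have z_edge: "path_image (\<gamma> z v) \<inter> path_image (c w) = {}"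
    if v: "v \<in> {b1, b2, b3}" and w: "w \<in> {b1, b2, b3}" and "v \<noteq> w" for v w
  proof -
    note edges = common[OF v] common[OF w]
    have "path_image (\<gamma> z v) \<inter> path_image (\<gamma> x w) \<subseteq> {}"
      using cross[of z v x w] edges \<open>v \<noteq> w\<close> distinct by (auto simp: doubleton_eq_iff)
    moreover have "path_image (\<gamma> z v) \<inter> path_image (\<gamma> w y) \<subseteq> {}"
      using cross[of z v w y] edges \<open>v \<noteq> w\<close> distinct by (auto simp: doubleton_eq_iff)
    ultimately show ?thesis
      unfolding c_image[OF w] by blast
  qed
  have z_conn: "connected (path_image (\<gamma> z v))" "p z \<in> path_image (\<gamma> z v)" "p v \<in> path_image (\<gamma> z v)"
    and not_end: "p v \<notin> {p x, p y}"
    if v: "v \<in> {b1, b2, b3}" for v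
    using arc ends common[OF v] vertex[OF v] inj by (auto simp: arc_imp_path connected_path_image)
  have mem: "b1 \<in> {b1, b2, b3}" "b2 \<in> {b1, b2, b3}" "b3 \<in> {b1, b2, b3}"
    by auto
  have z_edges: "path_image (\<gamma> z v) \<inter> (path_image (c w) \<union> path_image (c w')) = {}"
    if "v \<in> {b1, b2, b3}" "w \<in> {b1, b2, b3}" "w' \<in> {b1, b2, b3}" "v \<noteq> w" "v \<noteq> w'" for v w w'
    using z_edge[of v w] z_edge[of v w'] that by blast
  show False
    by (rule theta_no_common_access[OF c_arc(1-3)[OF mem(1)] c_arc(1-3)[OF mem(2)]
          c_arc(1-3)[OF mem(3)] c_Int[OF mem(1,2) b(2)] c_Int[OF mem(1,3) b(3)]
          c_Int[OF mem(2,3) b(4)] c_arc(4)[OF mem(1)] not_end[OF mem(1)]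
          c_arc(4)[OF mem(2)] not_end[OF mem(2)] c_arc(4)[OF mem(3)] not_end[OF mem(3)]
          z_conn[OF mem(1)] z_edges[OF mem b(2,3)]
          z_conn[OF mem(2)] z_edges[OF mem(2,1,3) b(2)[symmetric] b(4)]
          z_conn[OF mem(3)] z_edges[OF mem(3,1,2) b(3)[symmetric] b(4)[symmetric]]])
qed

section \<open>Counting leaves\<close>

text \<open>Only the disjoint stars at the spine vertices matter for the count, so the spine edges
  are forgotten. \<open>0 < n div m\<close> ensures that the pairs \<open>(i, 0)\<close> with
  \<open>i < m\<close> are vertices.\<close>

lemma contained_in_caterpillarE:
  assumes "contained_in (caterpillar n m) G" and "0 < n div m"
  obtains S L where "card S = m" "finite S" "S \<subseteq> pverts G"
    and "\<And>u v. u \<in> S \<Longrightarrow> v \<in> L u \<Longrightarrow> (u, v) \<in> parcs G"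
    and "\<And>u. u \<in> S \<Longrightarrow> card (L u) = n div m - 1"
    and "disjoint_family_on L S"
proof -
  obtain f where inj: "inj_on f ({..<m} \<times> {..<n div m})"
    and verts: "f ` ({..<m} \<times> {..<n div m}) \<subseteq> pverts G"
    and arcs: "\<And>u v. (u, v) \<in> parcs (caterpillar n m) \<Longrightarrow> (f u, f v) \<in> parcs G"
    using assms(1) by (auto simp: contained_in_def caterpillar_def Let_def)
  define h where "h i = f (i, 0)" for i :: nat
  define M where "M i = f ` ({i} \<times> {1..<n div m})" for i
  have inj_h: "inj_on h {..<m}"
    using assms(2) by (auto simp: h_def intro!: inj_onI dest: inj_onD[OF inj])
  have "(h i, v) \<in> parcs G" if "i < m" "v \<in> M i" for i v
    using that assms(2) by (auto simp: h_def M_def caterpillar_def Let_def intro!: arcs)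
  moreover have "card (M i) = n div m - 1" if "i < m" for i
  proof -
    have "inj_on f ({i} \<times> {1..<n div m})"
      by (rule inj_on_subset[OF inj]) (use that in auto)
    then show ?thesis
      by (simp add: M_def card_image)
  qed
  moreover have "h ` {..<m} \<subseteq> pverts G"
    using verts assms(2) by (auto simp: h_def)
  moreover have "M i \<inter> M j = {}" if "i < m" "j < m" "h i \<noteq> h j" for i j
    using that by (fastforce simp: M_def dest: inj_onD[OF inj])
  \<comment> \<open>\<open>M\<close> is indexed by spine positions; inverting \<open>h\<close>
    reindexes the leaf sets by vertices of \<open>G\<close>.\<close>
  ultimately show thesis
    using inj_h the_inv_into_f_f[OF inj_h]
    by (intro that[of "h ` {..<m}" "\<lambda>u. M (the_inv_into {..<m} h u)"])
      (auto simp: card_image disjoint_family_on_def)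
qed

text \<open>Each element of \<open>V\<close> is counted at most twice on the left unless it lies in
  all three sets, where it is counted once more.\<close>

lemma card_three_subsets_le:
  assumes "finite V" "A \<subseteq> V" "B \<subseteq> V" "T \<subseteq> V"
  shows "card A + card B + card T \<le> 2 * card V + card (A \<inter> B \<inter> T)"
proof -
  have fin: "finite A" "finite B" "finite T"
    using assms finite_subset by blast+
  have "card A + card B = card (A \<union> B) + card (A \<inter> B)"
    using fin by (intro card_Un_Int)
  moreover have "card (A \<inter> B) + card T = card (A \<inter> B \<union> T) + card (A \<inter> B \<inter> T)"
    using fin by (intro card_Un_Int) auto
  moreover have "card (A \<union> B) \<le> card V" "card (A \<inter> B \<union> T) \<le> card V"
    using assms by (auto intro!: card_mono)
  ultimately show ?thesis by linarith
qed

text \<open>The bound before halving, in natural numbers. The summand 1 pays for \<open>s\<close>,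
  and the factor 2 is the bound on common neighbours for each pair \<open>u, w\<close>.\<close>

lemma planar_three_caterpillars_card:
  fixes G :: "'a pair_pre_digraph"
  assumes G: "pair_graph G" "planar G"
    and kl: "1 \<le> k" "k \<le> l" and n: "0 < n" "k dvd n" "l dvd n"
    and star: "contained_in (caterpillar n 1) G"
    and cat_k: "contained_in (caterpillar n k) G"
    and cat_l: "contained_in (caterpillar n l) G"
  shows "(k - 1) * (n div k - 1) + (l - k) * (n div l - 1) + n
           \<le> 2 * card (pverts G) + 1 + 2 * ((k - 1) * (l - k))"
proof -
  interpret pair_graph G by fact
  have pos: "0 < n div k" "0 < n div l"
    using n kl by (simp_all add: div_greater_zero_iff dvd_imp_le)
  obtain S0 L0 where S0: "card S0 = 1" "finite S0"
      "\<And>u v. u \<in> S0 \<Longrightarrow> v \<in> L0 u \<Longrightarrow> (u, v) \<in> parcs G"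
      "\<And>u. u \<in> S0 \<Longrightarrow> card (L0 u) = n - 1" "S0 \<subseteq> pverts G"
    using contained_in_caterpillarE[OF star] n by (metis div_by_1)
  then obtain s where s: "S0 = {s}"
    by (auto simp: card_1_singleton_iff)
  obtain Sk Lk where Sk: "card Sk = k" "finite Sk"
      "\<And>u v. u \<in> Sk \<Longrightarrow> v \<in> Lk u \<Longrightarrow> (u, v) \<in> parcs G"
      "\<And>u. u \<in> Sk \<Longrightarrow> card (Lk u) = n div k - 1" "disjoint_family_on Lk Sk"
    using contained_in_caterpillarE[OF cat_k pos(1)] by metis
  obtain Sl Ll where Sl: "card Sl = l" "finite Sl"
      "\<And>u v. u \<in> Sl \<Longrightarrow> v \<in> Ll u \<Longrightarrow> (u, v) \<in> parcs G"
      "\<And>u. u \<in> Sl \<Longrightarrow> card (Ll u) = n div l - 1" "disjoint_family_on Ll Sl"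
    using contained_in_caterpillarE[OF cat_l pos(2)] by metis
  \<comment> \<open>Avoiding \<open>s\<close> costs at most one vertex of \<open>Sk\<close>, and
    avoiding \<open>s\<close> and \<open>U\<close> at most \<open>k\<close> vertices of
    \<open>Sl\<close>. The choices make \<open>s\<close>, \<open>u\<close>, \<open>w\<close>
    pairwise distinct.\<close>
  have "k - 1 \<le> card (Sk - {s})"
    using Sk diff_card_le_card_Diff[of "{s}" Sk] by simp
  then obtain U where U: "U \<subseteq> Sk - {s}" "card U = k - 1" "finite U"
    using obtain_subset_with_card_n by metis
  have "card (insert s U) \<le> k"
    using U kl card_insert_le_m1[of k U s] by simp
  then have "l - k \<le> card (Sl - insert s U)"
    using Sl U diff_card_le_card_Diff[of "insert s U" Sl] by simp
  then obtain W where W: "W \<subseteq> Sl - insert s U" "card W = l - k" "finite W"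
    using obtain_subset_with_card_n by metis
  define A where "A = (\<Union>u\<in>U. Lk u)"
  define B where "B = (\<Union>w\<in>W. Ll w)"
  \<comment> \<open>Including the centre gives \<open>T\<close> exactly \<open>n\<close> elements,
    but \<open>s\<close> may then lie in the triple intersection without being a common
    neighbour.\<close>
  define T where "T = insert s (L0 s)"
  have sub0: "L0 s \<subseteq> pverts G"
    using S0(3) s in_arcsD2 by blast
  have subk: "Lk u \<subseteq> pverts G" if "u \<in> U" for u
    using Sk(3)[of u] U(1) in_arcsD2 that by blast
  have subl: "Ll w \<subseteq> pverts G" if "w \<in> W" for w
    using Sl(3)[of w] W(1) in_arcsD2 that by blast
  note fin = sub0[THEN finite_subset, OF pair_finite_verts]
    subk[THEN finite_subset, OF _ pair_finite_verts] subl[THEN finite_subset, OF _ pair_finite_verts]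
  have "card A = (\<Sum>u\<in>U. card (Lk u))"
    unfolding A_def using Sk(5) U fin(2)
    by (intro card_UN_disjoint') (auto intro: disjoint_family_on_mono[of _ Sk])
  also have "\<dots> = (k - 1) * (n div k - 1)"
    using Sk(4) U by (subst sum.cong[OF refl, of _ _ "\<lambda>_. n div k - 1"]) auto
  finally have card_A: "card A = (k - 1) * (n div k - 1)" .
  have "card B = (\<Sum>w\<in>W. card (Ll w))"
    unfolding B_def using Sl(5) W fin(3)
    by (intro card_UN_disjoint') (auto intro: disjoint_family_on_mono[of _ Sl])
  also have "\<dots> = (l - k) * (n div l - 1)"
    using Sl(4) W by (subst sum.cong[OF refl, of _ _ "\<lambda>_. n div l - 1"]) auto
  finally have card_B: "card B = (l - k) * (n div l - 1)" .
  have "s \<notin> L0 s"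
    using S0(3) s no_loops by fastforce
  then have card_T: "card T = n"
    using S0(4) s fin(1) n by (simp add: T_def)
  have "s \<in> pverts G"
    using S0(5) s by simp
  then have subs: "A \<subseteq> pverts G" "B \<subseteq> pverts G" "T \<subseteq> pverts G"
    unfolding A_def B_def T_def using sub0 subk subl by blast+
  define C where "C u w = {v. (s, v) \<in> parcs G \<and> (u, v) \<in> parcs G \<and> (w, v) \<in> parcs G}" for u w
  have finC: "finite (C u w)" for u w
    by (rule finite_subset[of _ "pverts G"]) (use in_arcsD2 in \<open>auto simp: C_def\<close>)
  have C_le: "card (C u w) \<le> 2" if "u \<in> U" "w \<in> W" for u w
    unfolding C_def by (rule planar_common_neighbours[OF G]) (use that U(1) W(1) in blast)+
  have "A \<inter> B \<inter> T \<subseteq> insert s (\<Union>(u, w)\<in>U \<times> W. C u w)"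
    using S0(3) Sk(3) Sl(3) s U(1) W(1) unfolding A_def B_def T_def C_def by fast
  then have "card (A \<inter> B \<inter> T) \<le> card (insert s (\<Union>(u, w)\<in>U \<times> W. C u w))"
    by (rule card_mono[rotated]) (use U W finC in auto)
  also have "\<dots> \<le> Suc (card (\<Union>(u, w)\<in>U \<times> W. C u w))"
    by (rule card_insert_le_m1) auto
  also have "\<dots> \<le> Suc (\<Sum>(u, w)\<in>U \<times> W. card (C u w))"
    using card_UN_le[of "U \<times> W" "\<lambda>(u, w). C u w"] U W by (simp add: case_prod_unfold)
  also have "\<dots> \<le> Suc (\<Sum>(u, w)\<in>U \<times> W. 2)"
    using C_le by (intro Suc_le_mono[THEN iffD2] sum_mono) auto
  also have "\<dots> = 1 + 2 * ((k - 1) * (l - k))"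
    using U W by (simp add: card_cartesian_product case_prod_unfold)
  finally have "card (A \<inter> B \<inter> T) \<le> 1 + 2 * ((k - 1) * (l - k))" .
  then show ?thesis
    using card_three_subsets_le[OF pair_finite_verts subs] card_A card_B card_T by linarith
qed

theorem theorem10:
  fixes k l :: nat
  assumes "1 < k" and "k + 2 < l"
  shows "\<forall>\<^sub>F n in sequentially. k dvd n \<longrightarrow> l dvd n \<longrightarrow>
           (\<forall>G :: 'a pair_pre_digraph.
              pair_graph G \<longrightarrow> planar G \<longrightarrow>
              contained_in (caterpillar n 1) G \<longrightarrow>
              contained_in (caterpillar n k) G \<longrightarrow>
              contained_in (caterpillar n l) G \<longrightarrow>
              real (card (pverts G)) \<ge>
                (3 / 2 - 1 / real k - real k / real l) * real n
                - (real k - 1) * (real l - real k) - real l / 2)"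
  \<comment> \<open>Zero serves as threshold: together with divisibility, \<open>0 < n\<close> makes
    \<open>n div k\<close> and \<open>n div l\<close> positive, so the truncated subtractions become
    real ones.\<close>
  using eventually_gt_at_top[of 0]
proof eventually_elim
  case (elim n)
  show ?case
  proof (intro impI allI)
    fix G :: "'a pair_pre_digraph"
    assume dvd: "k dvd n" "l dvd n" and G: "pair_graph G" "planar G"
      and cats: "contained_in (caterpillar n 1) G" "contained_in (caterpillar n k) G"
        "contained_in (caterpillar n l) G"
    let ?N = "real (card (pverts G))"
    have pos: "0 < n div k" "0 < n div l"
      using elim assms dvd by (simp_all add: div_greater_zero_iff dvd_imp_le)
    have "real ((k - 1) * (n div k - 1) + (l - k) * (n div l - 1) + n)
        \<le> real (2 * card (pverts G) + 1 + 2 * ((k - 1) * (l - k)))"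
      using planar_three_caterpillars_card[OF G _ _ elim dvd cats] assms
      by (intro of_nat_mono) simp
    then have "(real k - 1) * (real n / real k - 1) + (real l - real k) * (real n / real l - 1) + real n
        \<le> 2 * ?N + 1 + 2 * ((real k - 1) * (real l - real k))"
      using assms dvd pos by (simp add: of_nat_diff real_of_nat_div Suc_leI)
    moreover have "(real k - 1) * (real n / real k - 1) = real n - real n / real k - (real k - 1)"
      using assms by (simp add: field_simps)
    moreover have "(real l - real k) * (real n / real l - 1)
        = real n - real k * real n / real l - (real l - real k)"
      using assms by (simp add: field_simps)
    \<comment> \<open>Halving yields the bound with \<open>1 / (2 k)\<close> and
      \<open>k / (2 l)\<close> in place of \<open>1 / k\<close> and \<open>k / l\<close>.
      Nonnegativity of the two fractions weakens it to the stated form, and the constants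
      \<open>(l - 1) + 1\<close> combine to \<open>l / 2\<close>.\<close>
    moreover have "0 \<le> real n / real k" "0 \<le> real k * real n / real l"
      by simp_all
    moreover have "(3 / 2 - 1 / real k - real k / real l) * real n
        = 3 / 2 * real n - real n / real k - real k * real n / real l"
      by (simp add: algebra_simps)
    ultimately show "?N \<ge> (3 / 2 - 1 / real k - real k / real l) * real n
        - (real k - 1) * (real l - real k) - real l / 2"
      by linarith
  qed
qed

end
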